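(* Let $\{H_1,H_2,\dots,H_m\}$ be a (nonempty) set of mutually unbiased Hadamard matrices of order $n$. Let $p$ be a prime number dividing $\sqrt n$ (in particular $\sqrt n$ is an integer), and let $q=p^r$ for a positive integer $r$. Let $\overline{\mathcal H}$ be the matrix algebra over $\mathbb F_q$ generated by $H_1,\dots,H_m$. Then the set of row spaces of the matrices $$\left[\begin{array}{c|c} X & \alpha I_n\end{array}\right],\qquad X\in\overline{\mathcal H}\setminus\{0\},\ \alpha\in\mathbb F_q\setminus\{0\},$$ is an LCD subspace code $C_S$ of subspaces of $\mathbb F_q^{2n}$.
   Context: A Hadamard matrix of order $n$ is an $n\times n$ $(-1,1)$-matrix $H$ with $HH^\top=nI_n$. Two Hadamard matrices $H,K$ of order $n$ are unbiased if $HK^\top=\sqrt n\,L$ for some Hadamard matrix $L$ of order $n$; a set of Hadamard matrices is mutually unbiased if any two distinct members are unbiased. The integer matrices $H_i$ are reduced modulo $p$ and regarded as matrices over $\mathbb F_q$. The matrix algebra generated by a set of matrices is the $\mathbb F_q$-linear span of all finite products (of length at least one) of these matrices; the identity matrix is not adjoined. $I_n$ is the identity matrix of order $n$. A subspace code is a nonempty set of subspaces of a vector space $\mathbb F_q^N$. A subspace code $C_S$ is an LCD subspace code if $U\cap W^\perp=\{0\}$ for all $U,W\in C_S$ (including $U=W$), where $\perp$ is with respect to the Euclidean inner product. *)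

theory Defs
  imports Complex_Main "Jordan_Normal_Form.VS_Connect" "HOL-Computational_Algebra.Primes"
begin

definition hadamard_mat :: "nat \<Rightarrow> int mat \<Rightarrow> bool" where
  "hadamard_mat n H \<longleftrightarrow>
     H \<in> carrier_mat n n \<and> elements_mat H \<subseteq> {-1, 1} \<and> H * H\<^sup>T = int n \<cdot>\<^sub>m 1\<^sub>m n"

text \<open>The equation \<open>H K\<^sup>T = \<surd>n L\<close> is stated over the reals, so that it makes sense for every
  \<open>n\<close>, whether or not \<open>n\<close> is a perfect square.\<close>

definition unbiased :: "nat \<Rightarrow> int mat \<Rightarrow> int mat \<Rightarrow> bool" where
  "unbiased n H K \<longleftrightarrow>
     (\<exists>L. hadamard_mat n L \<and>
          map_mat real_of_int (H * K\<^sup>T) = sqrt (real n) \<cdot>\<^sub>m map_mat real_of_int L)"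

definition mutually_unbiased_hadamard :: "nat \<Rightarrow> int mat set \<Rightarrow> bool" where
  "mutually_unbiased_hadamard n \<H> \<longleftrightarrow>
     (\<forall>H\<in>\<H>. hadamard_mat n H) \<and>
     (\<forall>H\<in>\<H>. \<forall>K\<in>\<H>. H \<noteq> K \<longrightarrow> unbiased n H K)"

text \<open>Products of length at least one; the empty product \<open>1\<^sub>m n\<close> is not included.\<close>

inductive_set mat_products :: "'a :: semiring_0 mat set \<Rightarrow> 'a mat set"
  for G :: "'a mat set" where
  gen: "A \<in> G \<Longrightarrow> A \<in> mat_products G"
| mult: "A \<in> mat_products G \<Longrightarrow> B \<in> G \<Longrightarrow> A * B \<in> mat_products G"

definition mat_algebra :: "nat \<Rightarrow> 'a :: field mat set \<Rightarrow> 'a mat set" where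
  "mat_algebra n G =
     LinearCombinations.module.span class_ring (module_mat TYPE('a) n n) (mat_products G)"

definition append_cols :: "'a :: zero mat \<Rightarrow> 'a mat \<Rightarrow> 'a mat" where
  "append_cols A B = four_block_mat A B (0\<^sub>m 0 (dim_col A)) (0\<^sub>m 0 (dim_col B))"

definition subspace_code :: "nat \<Rightarrow> 'a :: field vec set set \<Rightarrow> bool" where
  "subspace_code N C \<longleftrightarrow>
     C \<noteq> {} \<and> (\<forall>U\<in>C. VectorSpace.subspace class_ring U (module_vec TYPE('a) N))"

definition lcd_subspace_code :: "nat \<Rightarrow> 'a :: field vec set set \<Rightarrow> bool" where
  "lcd_subspace_code N C \<longleftrightarrow>
     subspace_code N C \<and>
     (\<forall>U\<in>C. \<forall>W\<in>C. U \<inter> vec_module.orthogonal_complement N W = {0\<^sub>v N})"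

end

theory Submission
  imports Defs
begin

text \<open>Modulo \<open>p\<close>, the generators annihilate each other's transposes: \<open>H H\<^sup>T = n I\<close> and
  \<open>H K\<^sup>T = \<surd>n L\<close> both vanish, because \<open>p\<close> divides \<open>\<surd>n\<close>. A product of generators ends
  in a generator, so the relation \<open>X Y\<^sup>T = 0\<close> passes from the generators to all \<open>X\<close> and \<open>Y\<close> in the
  algebra (\<open>mat_algebra_mult_transpose_eq_0\<close>). It is essential here that the identity matrix is not
  adjoined.

  Consequently the matrices \<open>M = [X | \<alpha> I]\<close> and \<open>N = [Y | \<beta> I]\<close> satisfy
  \<open>N M\<^sup>T = Y X\<^sup>T + \<alpha> \<beta> I = \<alpha> \<beta> I\<close>, which is invertible. A vector \<open>M\<^sup>T a\<close> of the row space of \<open>M\<close> that is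
  orthogonal to the row space of \<open>N\<close> then satisfies \<open>0 = N M\<^sup>T a = \<alpha> \<beta> a\<close>, so \<open>a = 0\<close>
  (\<open>row_space_Int_orthogonal_complement_eq_0\<close>).\<close>

section \<open>Characteristic of a finite ring\<close>

text \<open>Translation by \<open>1\<close> permutes a finite ring, so it does not change the sum of all elements.\<close>

lemma of_nat_card_UNIV_eq_0:
  "of_nat (card (UNIV :: 'a set)) = (0 :: 'a :: {ring_1, finite})"
proof -
  have "(\<Sum>x\<in>UNIV. x + 1) = (\<Sum>x\<in>UNIV. x :: 'a)"
    by (rule sum.reindex_bij_witness[where i = "\<lambda>x. x - 1" and j = "\<lambda>x. x + 1"]) auto
  then show ?thesis
    by (simp add: sum.distrib)
qed

section \<open>Matrix algebras without unit\<close>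

lemma mat_products_carrier:
  assumes "G \<subseteq> carrier_mat n n"
  shows "mat_products G \<subseteq> carrier_mat n n"
proof
  fix A assume "A \<in> mat_products G"
  then show "A \<in> carrier_mat n n"
    using assms by (induction rule: mat_products.induct) auto
qed

lemma mat_algebra_superset:
  fixes G :: "'a :: field mat set"
  assumes "G \<subseteq> carrier_mat n n"
  shows "G \<subseteq> mat_algebra n G"
proof -
  interpret vectorspace "class_ring :: 'a ring" "module_mat TYPE('a) n n"
    by (rule matrix_vs)
  have "mat_products G \<subseteq> mat_algebra n G"
    unfolding mat_algebra_def
    using mat_products_carrier[OF assms] by (intro in_own_span) (simp add: matrix_vs_simps)
  then show ?thesis
    by (auto intro: mat_products.gen)
qed

text \<open>The matrices that \<open>C\<close> annihilates from the right form a linear subspace, and every product of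
  generators lies in it because its last factor does.\<close>

lemma mat_algebra_mult_eq_0:
  fixes G :: "'a :: field mat set"
  assumes G: "G \<subseteq> carrier_mat n n" and C: "C \<in> carrier_mat n n"
    and ann: "\<And>A. A \<in> G \<Longrightarrow> A * C = 0\<^sub>m n n"
    and X: "X \<in> mat_algebra n G"
  shows "X \<in> carrier_mat n n" and "X * C = 0\<^sub>m n n"
proof -
  interpret vectorspace "class_ring :: 'a ring" "module_mat TYPE('a) n n"
    by (rule matrix_vs)
  let ?S = "{A \<in> carrier_mat n n. A * C = 0\<^sub>m n n}"
  have "A \<in> ?S" if "A \<in> mat_products G" for A
    using that
  proof induction
    case (gen A)
    then show ?case using G ann by auto
  next
    case (mult A B)
    have B: "B \<in> carrier_mat n n"
      using mult G by auto
    have "A * B * C = A * (B * C)"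
      using mult B C by (intro assoc_mult_mat) auto
    then show ?case
      using mult B ann by auto
  qed
  moreover have "submodule class_ring ?S (module_mat TYPE('a) n n)"
  proof (unfold_locales, unfold matrix_vs_simps)
    show "?S \<subseteq> carrier_mat n n" by auto
    show "A + B \<in> ?S" if "A \<in> ?S" "B \<in> ?S" for A B
      using that C by (auto simp: add_mult_distrib_mat[of _ n n])
    show "0\<^sub>m n n \<in> ?S"
      using C by auto
    show "c \<cdot>\<^sub>m A \<in> ?S" if "A \<in> ?S" for c A
      using that C by (auto simp: mult_smult_assoc_mat[of _ n n])
  qed
  ultimately have "X \<in> ?S"
    using span_is_subset[of "mat_products G" ?S] X unfolding mat_algebra_def by blast
  then show "X \<in> carrier_mat n n" and "X * C = 0\<^sub>m n n"
    by auto
qed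

lemma mat_algebra_mult_transpose_eq_0:
  fixes G :: "'a :: field mat set"
  assumes G: "G \<subseteq> carrier_mat n n"
    and ann: "\<And>A B. A \<in> G \<Longrightarrow> B \<in> G \<Longrightarrow> A * B\<^sup>T = 0\<^sub>m n n"
    and X: "X \<in> mat_algebra n G" and Y: "Y \<in> mat_algebra n G"
  shows "X * Y\<^sup>T = 0\<^sub>m n n"
proof -
  have carrier: "Y \<in> carrier_mat n n"
    by (rule mat_algebra_mult_eq_0(1)[OF G zero_carrier_mat _ Y]) (use G in auto)
  (* Extend linearly in one factor, transpose, and extend in the other factor. *)
  have ann_Y: "A * Y\<^sup>T = 0\<^sub>m n n" if A: "A \<in> G" for A
  proof -
    have A': "A \<in> carrier_mat n n"
      using A G by auto
    have "Y * A\<^sup>T = 0\<^sub>m n n"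
      by (rule mat_algebra_mult_eq_0(2)[OF G _ _ Y]) (use A A' ann in auto)
    moreover have "A * Y\<^sup>T = (Y * A\<^sup>T)\<^sup>T"
      using carrier A' by (subst transpose_mult[of _ n n _ n]) auto
    ultimately show ?thesis by simp
  qed
  show ?thesis
    by (rule mat_algebra_mult_eq_0(2)[OF G _ ann_Y X]) (use carrier in auto)
qed

section \<open>Row spaces and orthogonality\<close>

text \<open>The matrix \<open>N M\<^sup>T\<close> represents the Euclidean pairing of the rows of \<open>N\<close> with those of \<open>M\<close>. As a
  nonzero multiple of the identity it makes this pairing nondegenerate.\<close>

lemma row_space_Int_orthogonal_complement_eq_0:
  fixes M N :: "'a :: field mat"
  assumes M: "M \<in> carrier_mat k m" and N: "N \<in> carrier_mat k m"
    and NM: "N * M\<^sup>T = c \<cdot>\<^sub>m 1\<^sub>m k" and c: "c \<noteq> 0"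
  shows "vec_space.row_space m M \<inter>
      vec_module.orthogonal_complement m (vec_space.row_space m N) = {0\<^sub>v m}"
proof -
  interpret vec_space "TYPE('a)" m .
  have "v = 0\<^sub>v m"
    if v: "v \<in> row_space M" and orth: "v \<in> orthogonal_complement (row_space N)" for v
  proof -
    obtain a where a: "a \<in> carrier_vec k" and va: "v = M\<^sup>T *\<^sub>v a"
      using v M unfolding row_space_eq[OF M] by auto
    have rows: "set (rows N) \<subseteq> carrier_vec m"
      using N rows_carrier[of N] by auto
    have orth': "v \<bullet> row N i = 0" if "i < k" for i
      using orth that N unfolding row_space_def in_orthogonal_complement_span[OF rows]
      unfolding orthogonal_complement_def by (auto simp: rows_def)
    have v': "v \<in> carrier_vec m"
      using va M a by auto
    have "c \<cdot>\<^sub>v a = (c \<cdot>\<^sub>m 1\<^sub>m k) *\<^sub>v a"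
      using a by (intro eq_vecI) auto
    also have "\<dots> = N *\<^sub>v v"
      unfolding NM[symmetric] va using M N a by (intro assoc_mult_mat_vec) auto
    also have "\<dots> = 0\<^sub>v k"
      using N v' orth' by (intro eq_vecI) (auto simp: comm_scalar_prod[of _ m v])
    finally have ca: "c \<cdot>\<^sub>v a = 0\<^sub>v k" .
    have "a = 0\<^sub>v k"
    proof (rule eq_vecI)
      fix i assume "i < dim_vec (0\<^sub>v k :: 'a vec)"
      then show "a $ i = 0\<^sub>v k $ i"
        using arg_cong[OF ca, of "\<lambda>w. w $ i"] a c by auto
    qed (use a in auto)
    then show ?thesis
      using va M by (auto intro!: eq_vecI)
  qed
  moreover have "0\<^sub>v m \<in> row_space M"
    unfolding row_space_eq[OF M] using M by (auto intro!: bexI[of _ "0\<^sub>v k"] eq_vecI)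
  moreover have "0\<^sub>v m \<in> orthogonal_complement (row_space N)"
    unfolding orthogonal_complement_def row_space_eq[OF N] using N by auto
  ultimately show ?thesis by blast
qed

lemma append_cols_carrier:
  assumes "A \<in> carrier_mat n k" and "B \<in> carrier_mat n m"
  shows "append_cols A B \<in> carrier_mat n (k + m)"
  using assms unfolding append_cols_def by auto

lemma append_cols_mult_transpose:
  fixes A B C D :: "'a :: comm_ring_1 mat"
  assumes A: "A \<in> carrier_mat n k" and B: "B \<in> carrier_mat n m"
    and C: "C \<in> carrier_mat n' k" and D: "D \<in> carrier_mat n' m"
  shows "append_cols A B * (append_cols C D)\<^sup>T = A * C\<^sup>T + B * D\<^sup>T"
proof -
  have "(append_cols C D)\<^sup>T = four_block_mat C\<^sup>T (0\<^sub>m k 0) D\<^sup>T (0\<^sub>m m 0)"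
    unfolding append_cols_def using C D
    by (subst transpose_four_block_mat[of _ n' k _ m _ 0]) auto
  then have "append_cols A B * (append_cols C D)\<^sup>T =
      four_block_mat A B (0\<^sub>m 0 k) (0\<^sub>m 0 m) * four_block_mat C\<^sup>T (0\<^sub>m k 0) D\<^sup>T (0\<^sub>m m 0)"
    using A B unfolding append_cols_def by auto
  also have "\<dots> = four_block_mat (A * C\<^sup>T + B * D\<^sup>T) (A * 0\<^sub>m k 0 + B * 0\<^sub>m m 0)
      (0\<^sub>m 0 k * C\<^sup>T + 0\<^sub>m 0 m * D\<^sup>T) (0\<^sub>m 0 k * 0\<^sub>m k 0 + 0\<^sub>m 0 m * 0\<^sub>m m 0)"
    by (rule mult_four_block_mat) (use A B C D in auto)
  also have "\<dots> = A * C\<^sup>T + B * D\<^sup>T"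
    using A B C D by (intro eq_matI) auto
  finally show ?thesis .
qed

section \<open>Unbiased Hadamard matrices modulo a prime\<close>

text \<open>The real equation between integer matrices descends to the integers because \<open>\<surd>n\<close> is the
  integer \<open>s\<close>. For \<open>H = K\<close> the factor is even \<open>n = s\<^sup>2\<close>, so one factor \<open>s\<close> goes into \<open>L\<close>; \<open>L\<close> is
  then just an integer matrix, in general not a Hadamard matrix.\<close>

lemma mutually_unbiased_hadamard_mult_transpose:
  assumes mub: "mutually_unbiased_hadamard n \<H>" and s: "sqrt (real n) = real s"
    and H: "H \<in> \<H>" and K: "K \<in> \<H>"
  shows "\<exists>L \<in> carrier_mat n n. H * K\<^sup>T = int s \<cdot>\<^sub>m L"
proof (cases "H = K")
  case True
  have "real n = (real s)\<^sup>2"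
    using s by (metis of_nat_0_le_iff real_sqrt_pow2)
  then have "n = s * s"
    by (metis of_nat_eq_iff of_nat_mult power2_eq_square)
  moreover have "H * K\<^sup>T = int n \<cdot>\<^sub>m 1\<^sub>m n"
    using True mub H unfolding mutually_unbiased_hadamard_def hadamard_mat_def by auto
  ultimately have "H * K\<^sup>T = int s \<cdot>\<^sub>m (int s \<cdot>\<^sub>m 1\<^sub>m n)"
    by (intro eq_matI) auto
  then show ?thesis by auto
next
  case False
  then obtain L where L: "L \<in> carrier_mat n n"
    and eq: "map_mat real_of_int (H * K\<^sup>T) = sqrt (real n) \<cdot>\<^sub>m map_mat real_of_int L"
    using mub H K unfolding mutually_unbiased_hadamard_def unbiased_def hadamard_mat_def by blast
  have "H \<in> carrier_mat n n" "K \<in> carrier_mat n n"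
    using mub H K unfolding mutually_unbiased_hadamard_def hadamard_mat_def by auto
  then have HK: "H * K\<^sup>T \<in> carrier_mat n n" by auto
  have "H * K\<^sup>T = int s \<cdot>\<^sub>m L"
  proof (rule eq_matI)
    fix i j assume "i < dim_row (int s \<cdot>\<^sub>m L)" "j < dim_col (int s \<cdot>\<^sub>m L)"
    then have ij: "i < n" "j < n" using L by auto
    have "real_of_int ((H * K\<^sup>T) $$ (i, j)) = map_mat real_of_int (H * K\<^sup>T) $$ (i, j)"
      using HK ij by (intro index_map_mat(1)[symmetric]) auto
    also have "\<dots> = real_of_int (int s * L $$ (i, j))"
      unfolding eq using L ij s by simp
    finally have "(H * K\<^sup>T) $$ (i, j) = int s * L $$ (i, j)"
      unfolding of_int_eq_iff .
    then show "(H * K\<^sup>T) $$ (i, j) = (int s \<cdot>\<^sub>m L) $$ (i, j)"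
      using L ij by simp
  qed (use L HK in auto)
  then show ?thesis using L by blast
qed

text \<open>This guarantees that the code is nonempty: the reduced generators survive because their entries
  are units in every field.\<close>

lemma map_mat_of_int_hadamard_nonzero:
  assumes "hadamard_mat n H" and "n > 0"
  shows "(map_mat of_int H :: 'a :: field mat) \<noteq> 0\<^sub>m n n"
proof
  assume eq: "map_mat of_int H = (0\<^sub>m n n :: 'a mat)"
  have H: "H \<in> carrier_mat n n" and el: "elements_mat H \<subseteq> {-1, 1}"
    using assms unfolding hadamard_mat_def by auto
  have "H $$ (0, 0) \<in> elements_mat H"
    using H assms(2) by (intro elements_matI[of _ n n 0 0]) auto
  then have "H $$ (0, 0) = -1 \<or> H $$ (0, 0) = 1"
    using el by auto
  moreover have "of_int (H $$ (0, 0)) = (0 :: 'a)"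
    using arg_cong[OF eq, of "\<lambda>A. A $$ (0, 0)"] H assms(2) by auto
  ultimately show False by auto
qed

section \<open>The subspace code\<close>

theorem theorem4:
  fixes n p q r :: nat
    and \<H> :: "int mat set"
  assumes "n > 0"
    and "finite \<H>" and "\<H> \<noteq> {}"
    and "mutually_unbiased_hadamard n \<H>"
    and "prime p"
    and "\<exists>s::nat. sqrt (real n) = real s \<and> p dvd s"
    and "r > 0" and "q = p ^ r"
    and "card (UNIV :: ('a :: {field, finite}) set) = q"
  shows "lcd_subspace_code (2 * n)
           {vec_space.row_space (2 * n) (append_cols X (\<alpha> \<cdot>\<^sub>m 1\<^sub>m n)) | X (\<alpha> :: 'a).
              X \<in> mat_algebra n (map_mat of_int ` \<H>) - {0\<^sub>m n n} \<and> \<alpha> \<in> UNIV - {0}}"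
proof -
  let ?G = "map_mat of_int ` \<H> :: 'a mat set"
  obtain s where s: "sqrt (real n) = real s" and ps: "p dvd s"
    using assms(6) by blast
  (* The field has p ^ r elements, so its characteristic is p and s vanishes in it. *)
  have "of_nat p ^ r = (0 :: 'a)"
    using of_nat_card_UNIV_eq_0[where 'a = 'a] assms(8,9) by simp
  then have "of_nat p = (0 :: 'a)" by simp
  with ps have s0: "of_nat s = (0 :: 'a)" by auto
  have hadamard: "hadamard_mat n H" if "H \<in> \<H>" for H
    using assms(4) that unfolding mutually_unbiased_hadamard_def by auto
  have \<H>: "H \<in> carrier_mat n n" if "H \<in> \<H>" for H
    using hadamard[OF that] unfolding hadamard_mat_def by auto
  then have G: "?G \<subseteq> carrier_mat n n" by auto
  have ann: "A * B\<^sup>T = 0\<^sub>m n n" if AB: "A \<in> ?G" "B \<in> ?G" for A B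
  proof -
    obtain H K where H: "H \<in> \<H>" "A = map_mat of_int H" and K: "K \<in> \<H>" "B = map_mat of_int K"
      using AB by auto
    obtain L where L: "L \<in> carrier_mat n n" "H * K\<^sup>T = int s \<cdot>\<^sub>m L"
      using mutually_unbiased_hadamard_mult_transpose[OF assms(4) s H(1) K(1)] by blast
    have "A * B\<^sup>T = map_mat of_int (H * K\<^sup>T)"
      unfolding H(2) K(2) map_mat_transpose
      using \<H>[OF H(1)] \<H>[OF K(1)] by (intro of_int_hom.mat_hom_mult[symmetric]) auto
    then show ?thesis
      unfolding L(2) using L(1) s0 by (intro eq_matI) auto
  qed
  have carrier: "X \<in> carrier_mat n n" if "X \<in> mat_algebra n ?G" for X
    by (rule mat_algebra_mult_eq_0(1)[OF G zero_carrier_mat _ that]) (use G in auto)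
  let ?M = "\<lambda>X (\<alpha> :: 'a). append_cols X (\<alpha> \<cdot>\<^sub>m 1\<^sub>m n)"
  have M: "?M X \<alpha> \<in> carrier_mat n (2 * n)" if "X \<in> mat_algebra n ?G" for X \<alpha>
    using append_cols_carrier[OF carrier[OF that], of "\<alpha> \<cdot>\<^sub>m 1\<^sub>m n" n] by (simp add: mult_2)
  obtain H where H: "H \<in> \<H>"
    using assms(3) by auto
  then have "map_mat of_int H \<in> mat_algebra n ?G - {0\<^sub>m n n}"
    using mat_algebra_superset[OF G] map_mat_of_int_hadamard_nonzero[OF hadamard[OF H] assms(1)]
    by auto
  then have nonempty: "\<exists>X (\<alpha> :: 'a). X \<in> mat_algebra n ?G - {0\<^sub>m n n} \<and> \<alpha> \<in> UNIV - {0}"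
    using zero_neq_one[where 'a = 'a] by (metis DiffI UNIV_I singletonD)
  interpret vec_space "TYPE('a)" "2 * n" .
  have subspace: "subspace class_ring (row_space (?M X \<alpha>)) V" if "X \<in> mat_algebra n ?G" for X \<alpha>
    unfolding row_space_def
    using rows_carrier[of "?M X \<alpha>"] M[OF that, of \<alpha>] by (intro span_is_subspace) auto
  have lcd: "row_space (?M X \<alpha>) \<inter> orthogonal_complement (row_space (?M Y \<beta>)) = {0\<^sub>v (2 * n)}"
    if X: "X \<in> mat_algebra n ?G" and Y: "Y \<in> mat_algebra n ?G" and "\<alpha> \<noteq> 0" "\<beta> \<noteq> 0" for X Y \<alpha> \<beta>
  proof (rule row_space_Int_orthogonal_complement_eq_0[OF M[OF X] M[OF Y]])
    have YX: "Y * X\<^sup>T = 0\<^sub>m n n"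
      using mat_algebra_mult_transpose_eq_0[OF G _ Y X] ann by blast
    have "?M Y \<beta> * (?M X \<alpha>)\<^sup>T = Y * X\<^sup>T + (\<beta> \<cdot>\<^sub>m 1\<^sub>m n) * (\<alpha> \<cdot>\<^sub>m 1\<^sub>m n)\<^sup>T"
      using carrier[OF X] carrier[OF Y] by (intro append_cols_mult_transpose) auto
    also have "\<dots> = (\<beta> * \<alpha>) \<cdot>\<^sub>m 1\<^sub>m n"
      unfolding YX by (intro eq_matI) auto
    finally show "?M Y \<beta> * (?M X \<alpha>)\<^sup>T = (\<beta> * \<alpha>) \<cdot>\<^sub>m 1\<^sub>m n" .
    show "\<beta> * \<alpha> \<noteq> 0"
      using that by simp
  qed
  show ?thesis
    unfolding lcd_subspace_code_def subspace_code_def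
  proof (intro conjI ballI, goal_cases)
    case 1
    then show ?case using nonempty by blast
  next
    case (2 U)
    then show ?case using subspace by blast
  next
    case (3 U W)
    then obtain X \<alpha> Y \<beta> where "U = row_space (?M X \<alpha>)" "W = row_space (?M Y \<beta>)"
      "X \<in> mat_algebra n ?G" "Y \<in> mat_algebra n ?G" "\<alpha> \<noteq> 0" "\<beta> \<noteq> 0"
      by blast
    then show ?case using lcd by simp
  qed
qed

end
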